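(* Let $q\ge 1$ and $n\ge 0$ be integers. Then for every $k\in\{0,1,\ldots,\lfloor n/q\rfloor\}$, $$a(n,k)=\sum_{j=k}^{\lfloor n/q\rfloor}(-1)^{k+j}\binom{j}{k}\frac{(n-(q-1)j)!}{j!}.$$
   Context: $S_n$ is the set of all permutations of $[n]=\{1,2,\ldots,n\}$ (with $S_0$ consisting of the single empty permutation). For a fixed integer $q\ge 1$, an adjacent $q$-cycle (A$q$C) of a permutation $\pi\in S_n$ is a cycle of length $q$ in the disjoint cycle decomposition of $\pi$ of the form $(a,a+1,a+2,\ldots,a+q-1)$, i.e. $\pi(a+i)=a+i+1$ for $0\le i\le q-2$ and $\pi(a+q-1)=a$ (for $q=1$ this is a fixed point). For fixed $q$, $a(n,k)$ denotes the number of permutations $\pi\in S_n$ having exactly $k$ A$q$C's. *)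

theory Defs
  imports Complex_Main "HOL-Combinatorics.Cycles"
begin

(* For a permutation p, support p x is the cycle of p through x, written as the list
   [x, p x, p (p x), ...]; it is [x] when x is a fixed point.  Of the q rotations that denote
   one and the same adjacent q-cycle, exactly one is an increasing list of consecutive numbers,
   so counting these lists counts the cycles. *)
definition adjacent_cycles :: "nat \<Rightarrow> nat \<Rightarrow> (nat \<Rightarrow> nat) \<Rightarrow> nat list set" where
  "adjacent_cycles q n p = {cs \<in> support p ` {1..n}. \<exists>a. cs = [a..<a + q]}"

definition num_perms_adjacent_cycles :: "nat \<Rightarrow> nat \<Rightarrow> nat \<Rightarrow> nat" where
  "num_perms_adjacent_cycles q n k =
     card {p. p permutes {1..n} \<and> card (adjacent_cycles q n p) = k}"

lemma adjacent_cycles_iff: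
  assumes "q \<ge> 1" and p: "p permutes {1..n}"
  shows "[a..<a + q] \<in> adjacent_cycles q n p \<longleftrightarrow>
    a \<in> {1..n} \<and> (\<forall>i < q - 1. p (a + i) = a + i + 1) \<and> p (a + q - 1) = a"
    (is "?L \<longleftrightarrow> ?R")
proof
  have perm: "permutation p" using p by (auto simp: permutation_permutes)
  assume ?L
  then obtain x where x: "x \<in> {1..n}" "[a..<a + q] = support p x"
    by (auto simp: adjacent_cycles_def)
  have len: "least_power p x = q"
    using arg_cong[OF x(2), of length] by simp
  have nth: "(p ^^ i) x = a + i" if "i < q" for i
    using arg_cong[OF x(2), of "\<lambda>l. l ! i"] that len by simp
  have xa: "x = a" using nth[of 0] assms(1) by simp
  have 1: "p (a + i) = a + i + 1" if "i < q - 1" for i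
    using nth[of i] nth[of "Suc i"] that by simp
  have "(p ^^ Suc (q - 1)) x = x"
    using least_power_of_permutation(1)[OF perm, of x] len assms(1) by (simp del: funpow.simps)
  then have "p ((p ^^ (q - 1)) x) = x" by (simp only: funpow.simps comp_apply)
  then have "p (a + q - 1) = a"
    using nth[of "q - 1"] assms(1) xa by simp
  with 1 x(1) xa show ?R by simp
next
  assume R: ?R
  have nth: "(p ^^ i) a = a + i" if "i < q" for i
    using that
  proof (induction i)
    case (Suc i)
    then have "p (a + i) = a + i + 1" using R by simp
    with Suc show ?case by simp
  qed simp
  have "p ((p ^^ (q - 1)) a) = a"
    using nth[of "q - 1"] R assms(1) by simp
  then have "(p ^^ Suc (q - 1)) a = a" by (simp only: funpow.simps comp_apply)
  then have "(p ^^ q) a = a" using assms(1) by (simp del: funpow.simps)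
  moreover have "(p ^^ m) a \<noteq> a" if "0 < m" "m < q" for m
    using nth[of m] that by simp
  ultimately have "least_power p a = q"
    unfolding least_power_def using assms(1)
    by (intro Least_equality) (auto simp: not_less[symmetric])
  then have "support p a = [a..<a + q]"
    by (intro nth_equalityI) (auto simp: nth)
  with R show ?L unfolding adjacent_cycles_def
    by (auto simp: image_iff intro!: bexI[of _ a])
qed

end

theory Submission
  imports Defs
begin

text \<open>
  The formula is inclusion-exclusion over the sets of starting points of adjacent cycles.
  If \<open>a\<close> and \<open>b > a\<close> both start an adjacent \<open>q\<close>-cycle of one permutation, then the blocks
  \<open>a, \<dots>, a + q - 1\<close> and \<open>b, \<dots>, b + q - 1\<close> are disjoint, so a set \<open>J\<close> of \<open>j\<close> such starting points
  is a packing of \<open>j\<close> disjoint intervals of length \<open>q\<close> into \<open>{1..n}\<close>. There are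
  \<open>(n - (q - 1) * j) choose j\<close> such packings, because contracting every interval to one point
  turns a packing into a \<open>j\<close>-subset of a set of size \<open>n - (q - 1) * j\<close>
  (\<open>card_interval_packings\<close>). A packing prescribes the permutation on \<open>q * j\<close> points, on which it
  already acts as a permutation, and leaves \<open>(n - q * j)!\<close> choices on the remaining points
  (\<open>card_permutations_with_cycles_at\<close>).

  Let \<open>c p\<close> be the number of adjacent \<open>q\<close>-cycles of \<open>p\<close>. Counting the pairs of a permutation \<open>p\<close>
  and a \<open>j\<close>-set of its starting points in two ways gives the binomial moments
  \<open>(\<Sum>p. c p choose j) = ((n - (q - 1) * j) choose j) * (n - q * j)! = (n - (q - 1) * j)! / j!\<close>
  (\<open>sum_choose_cycle_starts\<close>). The number of \<open>p\<close> with \<open>c p = k\<close> follows from these moments by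
  binomial inversion (\<open>binomial_inversion_indicator\<close>).
\<close>

section \<open>Binomial inversion\<close>

text \<open>
  For \<open>k \<le> m\<close> the product of the two binomial coefficients is
  \<open>(m choose k) * ((m - k) choose (j - k))\<close>, so the sum is \<open>m choose k\<close> times the alternating
  sum over a row of Pascal's triangle. The upper limit \<open>N\<close> is independent of \<open>m\<close>, so that the
  identity can be summed over objects with different values of \<open>m\<close>.
\<close>
lemma binomial_inversion_indicator:
  assumes "m \<le> N"
  shows "(\<Sum>j = k..N. (- 1) ^ (k + j) * real (j choose k) * real (m choose j))
    = (if m = k then 1 else 0)"
proof (cases "k \<le> m")
  case False
  then show ?thesis by (auto intro!: sum.neutral)
next
  case True
  have "(\<Sum>j = k..N. (- 1) ^ (k + j) * real (j choose k) * real (m choose j))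
      = (\<Sum>j = k..m. (- 1) ^ (k + j) * real (j choose k) * real (m choose j))"
    using assms by (intro sum.mono_neutral_right) auto
  also have "\<dots> = (\<Sum>i = 0..m - k.
      (- 1) ^ (k + (i + k)) * real ((i + k) choose k) * real (m choose (i + k)))"
    using sum.shift_bounds_cl_nat_ivl[of
        "\<lambda>j. (- 1) ^ (k + j) * real (j choose k) * real (m choose j)" 0 k "m - k"] True
    by simp
  also have "\<dots> = (\<Sum>i = 0..m - k. real (m choose k) * ((- 1) ^ i * real ((m - k) choose i)))"
  proof (rule sum.cong)
    fix i assume "i \<in> {0..m - k}"
    then have "(m choose (i + k)) * ((i + k) choose k) = (m choose k) * ((m - k) choose i)"
      using choose_mult[of k "i + k" m] True by simp
    then have "real (m choose (i + k)) * real ((i + k) choose k)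
        = real (m choose k) * real ((m - k) choose i)"
      by (metis of_nat_mult)
    moreover have "(- 1) ^ (k + (i + k)) = ((- 1) ^ i :: real)"
      by (simp add: power_add flip: power_mult_distrib)
    ultimately show "(- 1) ^ (k + (i + k)) * real ((i + k) choose k) * real (m choose (i + k))
        = real (m choose k) * ((- 1) ^ i * real ((m - k) choose i))"
      by (simp add: mult.commute mult.left_commute)
  qed simp
  also have "\<dots> = real (m choose k) * (\<Sum>i\<le>m - k. (- 1) ^ i * real ((m - k) choose i))"
    by (simp add: sum_distrib_left atMost_atLeast0)
  also have "\<dots> = (if m = k then 1 else 0)"
    using True choose_alternating_sum[of "m - k", where 'a = real] by auto
  finally show ?thesis .
qed

section \<open>Packings of intervals\<close>

definition separated :: "nat \<Rightarrow> nat set \<Rightarrow> bool" where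
  "separated q J \<longleftrightarrow> (\<forall>a \<in> J. \<forall>b \<in> J. a < b \<longrightarrow> a + q \<le> b)"

text \<open>A packing is encoded by the set of left endpoints of its intervals.\<close>
definition interval_packings :: "nat \<Rightarrow> nat \<Rightarrow> nat \<Rightarrow> nat set set" where
  "interval_packings q n j =
     {J. J \<subseteq> {1..n} \<and> (\<forall>a \<in> J. a + q \<le> Suc n) \<and> separated q J \<and> card J = j}"

lemma finite_interval_packings: "finite (interval_packings q n j)"
  by (rule finite_subset[of _ "Pow {1..n}"]) (auto simp: interval_packings_def)

text \<open>
  Pascal's rule for packings: either the position \<open>n\<close> is uncovered, or the last interval of the
  packing ends there and the others lie in \<open>{1..n - q}\<close>.
\<close>
lemma card_interval_packings_rec:
  assumes "q \<ge> 1" "n \<ge> q"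
  shows "card (interval_packings q n (Suc j)) =
    card (interval_packings q (n - 1) (Suc j)) + card (interval_packings q (n - q) j)"
proof -
  define t where "t = Suc n - q"
  have t: "t + q = Suc n" "t \<ge> 1" "t \<le> n" using assms by (auto simp: t_def)
  have notin: "t \<notin> J" if "J \<in> interval_packings q (n - q) j" for J
    using that assms t by (auto simp: interval_packings_def)
  have split: "interval_packings q n (Suc j) =
      interval_packings q (n - 1) (Suc j) \<union> insert t ` interval_packings q (n - q) j" (is "?L = ?R")
  proof (intro equalityI subsetI)
    fix J assume J: "J \<in> ?L"
    then have fin: "finite J" by (auto simp: interval_packings_def intro: finite_subset)
    show "J \<in> ?R"
    proof (cases "t \<in> J")
      case True
      have below: "a + q \<le> t" if "a \<in> J" "a \<noteq> t" for a
      proof -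
        have "a + q \<le> t + q" using J that t by (auto simp: interval_packings_def)
        then show ?thesis using J that True by (auto simp: interval_packings_def separated_def)
      qed
      have "J - {t} \<in> interval_packings q (n - q) j"
        using J below t True fin assms
        by (fastforce simp: interval_packings_def separated_def)
      moreover have "J = insert t (J - {t})" using True by auto
      ultimately show ?thesis by blast
    next
      case False
      have "a + q \<le> n" if "a \<in> J" for a
      proof -
        have "a + q \<le> Suc n" "a \<noteq> t" using J that False by (auto simp: interval_packings_def)
        then show ?thesis using t by linarith
      qed
      then have "J \<in> interval_packings q (n - 1) (Suc j)"
        using J assms by (fastforce simp: interval_packings_def)
      then show ?thesis by simp
    qed
  next
    fix J assume "J \<in> ?R"
    then show "J \<in> ?L"
    proof
      assume "J \<in> interval_packings q (n - 1) (Suc j)"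
      then show ?thesis using assms by (fastforce simp: interval_packings_def)
    next
      assume "J \<in> insert t ` interval_packings q (n - q) j"
      then obtain K where K: "J = insert t K" "K \<in> interval_packings q (n - q) j" by auto
      have "finite K" using K(2) by (auto simp: interval_packings_def intro: finite_subset)
      then have "card J = Suc j" using K notin by (auto simp: interval_packings_def)
      moreover have "a + q \<le> t" "1 \<le> a" if "a \<in> K" for a
        using K(2) that t assms by (auto simp: interval_packings_def)
      ultimately show ?thesis using K t
        by (fastforce simp: interval_packings_def separated_def)
    qed
  qed
  have "t \<notin> J" if "J \<in> interval_packings q (n - 1) (Suc j)" for J
    using that assms t by (auto simp: interval_packings_def)
  then have "interval_packings q (n - 1) (Suc j) \<inter> insert t ` interval_packings q (n - q) j = {}"
    by blast
  moreover have "inj_on (insert t) (interval_packings q (n - q) j)"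
    using notin by (intro inj_onI) (metis insert_ident)
  ultimately show ?thesis
    by (simp add: split card_Un_disjoint finite_interval_packings card_image)
qed

text \<open>
  Truncated subtraction is harmless here: if \<open>q * j > n\<close>, no packing exists, and the upper entry
  of the binomial coefficient is smaller than \<open>j\<close>.
\<close>
lemma card_interval_packings:
  assumes "q \<ge> 1"
  shows "card (interval_packings q n j) = (n - (q - 1) * j) choose j"
proof (induction n arbitrary: j rule: less_induct)
  case (less n)
  show ?case
  proof (cases j)
    case 0
    have "J = {}" if "J \<subseteq> {1..n}" "card J = 0" for J
      using that finite_subset[of J "{1..n}"] by simp
    then have "interval_packings q n 0 = {{}}"
      by (auto simp: interval_packings_def separated_def)
    then show ?thesis using 0 by simp
  next
    case (Suc i)
    show ?thesis
    proof (cases "n < q")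
      case True
      have "J = {}" if "J \<in> interval_packings q n j" for J
        using that True by (fastforce simp: interval_packings_def)
      then have "interval_packings q n j = {}"
        using Suc by (fastforce simp: interval_packings_def)
      moreover have "n - (q - 1) * j = 0" using True Suc by simp
      ultimately show ?thesis using Suc by simp
    next
      case False
      have "card (interval_packings q n j) =
          ((n - 1 - (q - 1) * Suc i) choose Suc i) + ((n - q - (q - 1) * i) choose i)"
        using card_interval_packings_rec[OF assms, of n i] less[of "n - 1" "Suc i"]
          less[of "n - q" i] False assms Suc by simp
      also have "\<dots> = (n - (q - 1) * Suc i) choose Suc i"
      proof (cases "n \<le> (q - 1) * Suc i")
        case True
        \<comment> \<open>All upper entries are \<open>0\<close>; the last summand vanishes because \<open>i = 0\<close> would give \<open>n < q\<close>.\<close>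
        then have "i > 0" using False assms by (cases i) auto
        moreover have "n - q - (q - 1) * i = 0" using True by simp
        moreover have "n - 1 - (q - 1) * Suc i = 0" "n - (q - 1) * Suc i = 0"
          using True by simp_all
        ultimately show ?thesis by (simp only: binomial_eq_0_iff) simp
      next
        case False
        define N where "N = n - 1 - (q - 1) * Suc i"
        have "n - (q - 1) * Suc i = Suc N" using False by (simp add: N_def)
        moreover have "n - q - (q - 1) * i = N" using assms by (simp add: N_def)
        ultimately show ?thesis by (simp only: N_def[symmetric] binomial_Suc_Suc add.commute)
      qed
      finally show ?thesis using Suc by simp
    qed
  qed
qed

lemma interval_packing_size:
  assumes "q \<ge> 1" "J \<in> interval_packings q n j"
  shows "q * j \<le> n"
proof -
  have "card (interval_packings q n j) \<noteq> 0"
    using assms(2) finite_interval_packings by auto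
  then have "j \<le> n - (q - 1) * j"
    using card_interval_packings[OF assms(1), of n j] by (simp add: not_less)
  then have "j + (q - 1) * j \<le> n \<or> j = 0" by linarith
  moreover have "j + (q - 1) * j = q * j" using assms(1) by (cases q) auto
  ultimately show ?thesis by auto
qed

section \<open>Permutations with prescribed adjacent cycles\<close>

text \<open>
  Composition with \<open>r\<close> turns the permutations of \<open>S - U\<close> into the permutations of \<open>S\<close> that agree
  with \<open>r\<close> on \<open>U\<close>.
\<close>
lemma card_permutations_extending:
  assumes "finite S" "U \<subseteq> S" and r: "r permutes U"
  shows "card {p. p permutes S \<and> (\<forall>x \<in> U. p x = r x)} = fact (card S - card U)"
proof -
  have rS: "r permutes S" using r assms(2) by (rule permutes_subset)
  have "bij_betw (\<lambda>s. s \<circ> r) {s. s permutes (S - U)} {p. p permutes S \<and> (\<forall>x \<in> U. p x = r x)}"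
  proof (rule bij_betw_byWitness[where f' = "\<lambda>p. p \<circ> inv r"])
    show "(\<lambda>s. s \<circ> r) ` {s. s permutes (S - U)} \<subseteq> {p. p permutes S \<and> (\<forall>x \<in> U. p x = r x)}"
    proof clarify
      fix s assume s: "s permutes (S - U)"
      then have "s permutes S" by (rule permutes_subset) auto
      then have "s \<circ> r permutes S" using rS by (rule permutes_compose[rotated])
      moreover have "(s \<circ> r) x = r x" if "x \<in> U" for x
        using permutes_not_in[OF s, of "r x"] permutes_in_image[OF r, of x] that by simp
      ultimately show "s \<circ> r permutes S \<and> (\<forall>x \<in> U. (s \<circ> r) x = r x)" by blast
    qed
    show "(\<lambda>p. p \<circ> inv r) ` {p. p permutes S \<and> (\<forall>x \<in> U. p x = r x)} \<subseteq> {s. s permutes (S - U)}"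
    proof clarify
      fix p assume p: "p permutes S" "\<forall>x \<in> U. p x = r x"
      have "p \<circ> inv r permutes S" using p(1) permutes_inv[OF rS] by (rule permutes_compose[rotated])
      moreover have "(p \<circ> inv r) x = x" if "x \<in> S - (S - U)" for x
      proof -
        have "inv r x \<in> U" using that permutes_in_image[OF permutes_inv[OF r], of x] by simp
        then show ?thesis using p(2) permutes_inverses(1)[OF r] by simp
      qed
      ultimately show "p \<circ> inv r permutes (S - U)" by (rule permutes_superset)
    qed
  qed (auto simp: comp_assoc permutes_inv_o[OF r])
  then have "card {p. p permutes S \<and> (\<forall>x \<in> U. p x = r x)} = card {s. s permutes (S - U)}"
    by (rule bij_betw_same_card[symmetric])
  also have "\<dots> = fact (card S - card U)"
    using assms by (intro card_permutations) (auto simp: card_Diff_subset finite_subset)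
  finally show ?thesis .
qed

definition cycle_at :: "nat \<Rightarrow> (nat \<Rightarrow> nat) \<Rightarrow> nat \<Rightarrow> bool" where
  "cycle_at q p a \<longleftrightarrow> (\<forall>i < q - 1. p (a + i) = a + i + 1) \<and> p (a + q - 1) = a"

definition cycle_starts :: "nat \<Rightarrow> nat \<Rightarrow> (nat \<Rightarrow> nat) \<Rightarrow> nat set" where
  "cycle_starts q n p = {a \<in> {1..n}. cycle_at q p a}"

definition blocks :: "nat \<Rightarrow> nat set \<Rightarrow> nat set" where
  "blocks q J = (\<Union>a \<in> J. {a..<a + q})"

text \<open>The product of the cycles \<open>(a, a + 1, \<dots>, a + q - 1)\<close> with \<open>a \<in> J\<close>, for separated \<open>J\<close>.\<close>
definition rotate_blocks :: "nat \<Rightarrow> nat set \<Rightarrow> nat \<Rightarrow> nat" where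
  "rotate_blocks q J x =
     (if x \<in> (\<lambda>a. a + (q - 1)) ` J then x - (q - 1) else if x \<in> blocks q J then Suc x else x)"

lemma blocksI: "a \<in> J \<Longrightarrow> i < q \<Longrightarrow> a + i \<in> blocks q J"
  unfolding blocks_def by (rule UN_I[of a]) auto

lemma rotate_blocks_apply:
  assumes "separated q J" "a \<in> J" "i < q"
  shows "rotate_blocks q J (a + i) = (if i = q - 1 then a else Suc (a + i))"
proof (cases "i = q - 1")
  case True
  then show ?thesis using assms by (auto simp: rotate_blocks_def)
next
  case False
  have "a + i \<noteq> b + (q - 1)" if "b \<in> J" for b
    using assms that False
    by (cases a b rule: linorder_cases) (fastforce simp: separated_def)+
  moreover have "a + i \<in> blocks q J" using assms(2,3) by (rule blocksI)
  ultimately show ?thesis using False by (auto simp: rotate_blocks_def)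
qed

lemma blocks_cases:
  assumes "x \<in> blocks q J"
  obtains a i where "a \<in> J" "i < q" "x = a + i"
proof -
  obtain a where "a \<in> J" "a \<le> x" "x < a + q" using assms by (auto simp: blocks_def)
  then show thesis using that[of a "x - a"] by auto
qed

lemma rotate_blocks_permutes:
  assumes "separated q J" "finite J" "q \<ge> 1"
  shows "rotate_blocks q J permutes blocks q J"
proof -
  let ?r = "rotate_blocks q J" and ?U = "blocks q J"
  have "finite ?U" using assms(2) by (auto simp: blocks_def)
  have into: "?r x \<in> ?U" if "x \<in> ?U" for x
    using that
  proof (rule blocks_cases)
    fix a i assume ai: "a \<in> J" "i < q" "x = a + i"
    show "?r x \<in> ?U"
    proof (cases "i = q - 1")
      case True
      then show ?thesis using ai rotate_blocks_apply[OF assms(1) ai(1,2)] blocksI[of a J 0 q] by simp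
    next
      case False
      then show ?thesis
        using ai rotate_blocks_apply[OF assms(1) ai(1,2)] blocksI[of a J "Suc i" q] by simp
    qed
  qed
  have onto: "x \<in> ?r ` ?U" if "x \<in> ?U" for x
    using that
  proof (rule blocks_cases)
    fix a i assume ai: "a \<in> J" "i < q" "x = a + i"
    define k where "k = (if i = 0 then q - 1 else i - 1)"
    have "k < q" using ai(2) by (auto simp: k_def)
    then have "?r (a + k) = x"
      using rotate_blocks_apply[OF assms(1) ai(1), of k] ai by (auto simp: k_def split: if_splits)
    then show "x \<in> ?r ` ?U" using blocksI[OF ai(1) \<open>k < q\<close>] by blast
  qed
  have "bij_betw ?r ?U ?U"
    unfolding bij_betw_def using into onto \<open>finite ?U\<close> by (auto intro!: finite_surj_inj)
  moreover have "?r x = x" if "x \<notin> ?U" for x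
    using that assms(3) by (auto simp: rotate_blocks_def blocks_def)
  ultimately show ?thesis by (rule bij_imp_permutes)
qed

lemma cycles_at_iff_rotate_blocks:
  assumes "separated q J" "q \<ge> 1"
  shows "(\<forall>a \<in> J. cycle_at q p a) \<longleftrightarrow> (\<forall>x \<in> blocks q J. p x = rotate_blocks q J x)"
proof
  assume L: "\<forall>a \<in> J. cycle_at q p a"
  show "\<forall>x \<in> blocks q J. p x = rotate_blocks q J x"
  proof
    fix x assume "x \<in> blocks q J"
    then show "p x = rotate_blocks q J x"
    proof (rule blocks_cases)
      fix a i assume ai: "a \<in> J" "i < q" "x = a + i"
      then show "p x = rotate_blocks q J x"
        using L rotate_blocks_apply[OF assms(1) ai(1,2)]
        by (auto simp: cycle_at_def)
    qed
  qed
next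
  assume R: "\<forall>x \<in> blocks q J. p x = rotate_blocks q J x"
  show "\<forall>a \<in> J. cycle_at q p a"
  proof
    fix a assume a: "a \<in> J"
    have "p (a + i) = (if i = q - 1 then a else Suc (a + i))" if "i < q" for i
      using R blocksI[OF a that] rotate_blocks_apply[OF assms(1) a that] by simp
    from this[of "q - 1"] this show "cycle_at q p a"
      using assms(2) by (auto simp: cycle_at_def)
  qed
qed

lemma card_blocks:
  assumes "separated q J" "finite J"
  shows "card (blocks q J) = q * card J"
proof -
  have "{a..<a + q} \<inter> {b..<b + q} = {}" if "a \<in> J" "b \<in> J" "a \<noteq> b" for a b
    using assms(1) that by (cases a b rule: linorder_cases) (fastforce simp: separated_def)+
  then have "card (blocks q J) = (\<Sum>a \<in> J. card {a..<a + q})"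
    unfolding blocks_def using assms(2) by (intro card_UN_disjoint) auto
  then show ?thesis by simp
qed

lemma card_permutations_with_cycles_at:
  assumes "q \<ge> 1" and J: "J \<in> interval_packings q n j"
  shows "card {p. p permutes {1..n} \<and> J \<subseteq> cycle_starts q n p} = fact (n - q * j)"
proof -
  have sep: "separated q J" and sub: "J \<subseteq> {1..n}" and "card J = j"
    using J by (auto simp: interval_packings_def)
  have fin: "finite J" using sub finite_subset by blast
  have "blocks q J \<subseteq> {1..n}"
    using J by (fastforce simp: interval_packings_def blocks_def)
  moreover have "J \<subseteq> cycle_starts q n p \<longleftrightarrow> (\<forall>x \<in> blocks q J. p x = rotate_blocks q J x)" for p
    using sub cycles_at_iff_rotate_blocks[OF sep assms(1), of p] by (auto simp: cycle_starts_def)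
  ultimately show ?thesis
    using card_permutations_extending[OF _ _ rotate_blocks_permutes[OF sep fin assms(1)], of "{1..n}"]
      card_blocks[OF sep fin] \<open>card J = j\<close> by simp
qed

section \<open>Counting by starting points\<close>

lemma card_adjacent_cycles:
  assumes "q \<ge> 1" "p permutes {1..n}"
  shows "card (adjacent_cycles q n p) = card (cycle_starts q n p)"
proof -
  have "adjacent_cycles q n p = (\<lambda>a. [a..<a + q]) ` cycle_starts q n p"
  proof -
    have "[a..<a + q] \<in> adjacent_cycles q n p \<longleftrightarrow> a \<in> cycle_starts q n p" for a
      by (simp only: adjacent_cycles_iff[OF assms] cycle_starts_def cycle_at_def mem_Collect_eq)
    moreover have "\<exists>a. cs = [a..<a + q]" if "cs \<in> adjacent_cycles q n p" for cs
      using that by (auto simp: adjacent_cycles_def)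
    ultimately show ?thesis by blast
  qed
  moreover have "inj_on (\<lambda>a. [a..<a + q]) (cycle_starts q n p)"
  proof (rule inj_onI)
    fix a b assume "[a..<a + q] = [b..<b + q]"
    then have "hd [a..<a + q] = hd [b..<b + q]" by simp
    then show "a = b" using assms(1) by simp
  qed
  ultimately show ?thesis by (simp add: card_image)
qed

text \<open>
  If the block at \<open>b\<close> started inside the block at \<open>a\<close>, then the last point of the block at \<open>a\<close>
  would be a point of the block at \<open>b\<close> other than its last one, so \<open>p\<close> would have to send it both
  back to \<open>a\<close> and one step up. A block also cannot stick out of \<open>{1..n}\<close>: its last point would be
  fixed by \<open>p\<close> instead of being sent back to \<open>a\<close>.
\<close>
lemma subset_cycle_starts_packing:
  assumes "q \<ge> 1" "p permutes {1..n}" "J \<subseteq> cycle_starts q n p"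
  shows "J \<in> interval_packings q n (card J)"
proof -
  have in_range: "a + q \<le> Suc n" if "a \<in> J" for a
  proof (rule ccontr)
    assume "\<not> a + q \<le> Suc n"
    moreover from this have "p (a + q - 1) = a + q - 1"
      by (intro permutes_not_in[OF assms(2)]) auto
    moreover have "p (a + q - 1) = a" "a \<le> n"
      using assms(3) that by (auto simp: cycle_starts_def cycle_at_def)
    ultimately show False using assms(1) by linarith
  qed
  have apart: "a + q \<le> b" if "a \<in> J" "b \<in> J" "a < b" for a b
  proof (rule ccontr)
    assume "\<not> a + q \<le> b"
    define i where "i = a + q - 1 - b"
    have i: "b + i = a + q - 1" "i < q - 1"
      using \<open>\<not> a + q \<le> b\<close> that(3) by (auto simp: i_def)
    have "p (b + i) = b + i + 1" "p (a + q - 1) = a"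
      using assms(3) that i(2) by (auto simp: cycle_starts_def cycle_at_def)
    then show False using i assms(1) by simp
  qed
  show ?thesis
    using in_range apart assms(3)
    by (auto simp: interval_packings_def separated_def cycle_starts_def)
qed

text \<open>
  Double counting of the pairs of a permutation and a \<open>j\<close>-set of its starting points. The right-hand
  side is \<open>(N choose j) * (N - j)!\<close> with \<open>N = n - (q - 1) * j\<close>: there are \<open>N choose j\<close> packings, and
  \<open>N - j = n - q * j\<close> points remain free for each of them.
\<close>
lemma sum_choose_cycle_starts:
  assumes "q \<ge> 1" "q * j \<le> n"
  shows "(\<Sum>p | p permutes {1..n}. real (card (cycle_starts q n p) choose j))
    = fact (n - (q - 1) * j) / fact j"
proof -
  let ?P = "{p. p permutes {1..n}}" and ?I = "interval_packings q n j"
  have "card (cycle_starts q n p) choose j = card {J \<in> ?I. J \<subseteq> cycle_starts q n p}"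
    if "p \<in> ?P" for p
  proof -
    have "finite (cycle_starts q n p)" by (simp add: cycle_starts_def)
    then have "card (cycle_starts q n p) choose j
        = card {J. J \<subseteq> cycle_starts q n p \<and> card J = j}"
      by (simp add: n_subsets)
    also have "{J. J \<subseteq> cycle_starts q n p \<and> card J = j} = {J \<in> ?I. J \<subseteq> cycle_starts q n p}"
    proof -
      have "card J = j" if "J \<in> ?I" for J using that by (simp add: interval_packings_def)
      then show ?thesis using subset_cycle_starts_packing[OF assms(1)] that by blast
    qed
    finally show ?thesis .
  qed
  then have "(\<Sum>p \<in> ?P. card (cycle_starts q n p) choose j)
      = (\<Sum>p \<in> ?P. \<Sum>J | J \<in> ?I \<and> J \<subseteq> cycle_starts q n p. 1)"
    by simp
  also have "\<dots> = (\<Sum>J \<in> ?I. \<Sum>p | p \<in> ?P \<and> J \<subseteq> cycle_starts q n p. 1)"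
    by (intro sum.swap_restrict finite_permutations finite_interval_packings) simp
  also have "\<dots> = (\<Sum>J \<in> ?I. fact (n - q * j))"
    using card_permutations_with_cycles_at[OF assms(1)] by (intro sum.cong) auto
  also have "\<dots> = ((n - (q - 1) * j) choose j) * fact (n - q * j)"
    by (simp add: card_interval_packings[OF assms(1)])
  finally have "(\<Sum>p \<in> ?P. real (card (cycle_starts q n p) choose j))
      = real (((n - (q - 1) * j) choose j) * fact (n - q * j))"
    by (simp flip: of_nat_sum)
  moreover have "q * j = (q - 1) * j + j" using assms(1) by (cases q) auto
  then have "j \<le> n - (q - 1) * j" "n - (q - 1) * j - j = n - q * j"
    using assms(2) by linarith+
  ultimately show ?thesis
    by (simp add: binomial_fact)
qed

theorem theorem2p1:
  fixes q n k :: nat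
  assumes "q \<ge> 1"
    and "k \<in> {0..n div q}"
  shows "real (num_perms_adjacent_cycles q n k) =
    (\<Sum>j = k..n div q. (- 1) ^ (k + j) * real (j choose k) * (fact (n - (q - 1) * j) / fact j))"
proof -
  let ?P = "{p. p permutes {1..n}}" and ?c = "\<lambda>p. card (cycle_starts q n p)"
  have finP: "finite ?P" by (simp add: finite_permutations)
  have bound: "?c p \<le> n div q" if "p \<in> ?P" for p
    using interval_packing_size[OF assms(1) subset_cycle_starts_packing[OF assms(1), of p n]] that
      assms(1) by (simp add: less_eq_div_iff_mult_less_eq mult.commute)
  have "num_perms_adjacent_cycles q n k = card {p \<in> ?P. ?c p = k}"
    unfolding num_perms_adjacent_cycles_def
    using card_adjacent_cycles[OF assms(1)] by (intro arg_cong[where f = card]) auto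
  then have "real (num_perms_adjacent_cycles q n k) = (\<Sum>p \<in> ?P. if ?c p = k then 1 else 0)"
    using sum.inter_filter[OF finP, of "\<lambda>_. 1 :: real" "\<lambda>p. ?c p = k"] by simp
  also have "\<dots> = (\<Sum>p \<in> ?P. \<Sum>j = k..n div q.
      (- 1) ^ (k + j) * real (j choose k) * real (?c p choose j))"
    using bound by (intro sum.cong refl binomial_inversion_indicator[symmetric])
  also have "\<dots> = (\<Sum>j = k..n div q.
      (- 1) ^ (k + j) * real (j choose k) * (\<Sum>p \<in> ?P. real (?c p choose j)))"
    by (subst sum.swap) (simp add: sum_distrib_left)
  also have "\<dots> = (\<Sum>j = k..n div q.
      (- 1) ^ (k + j) * real (j choose k) * (fact (n - (q - 1) * j) / fact j))"
  proof (rule sum.cong)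
    fix j assume "j \<in> {k..n div q}"
    then have "q * j \<le> n"
      using assms(1) by (simp add: less_eq_div_iff_mult_less_eq mult.commute)
    then show "(- 1) ^ (k + j) * real (j choose k) * (\<Sum>p \<in> ?P. real (?c p choose j))
        = (- 1) ^ (k + j) * real (j choose k) * (fact (n - (q - 1) * j) / fact j)"
      using sum_choose_cycle_starts[OF assms(1)] by simp
  qed simp
  finally show ?thesis .
qed

end
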